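(* Let $R:V^{\otimes 2}\to V^{\otimes 2}$ be a skew-invertible Hecke symmetry, and let $L=\|l_i^j\|$ be the matrix whose entries $l_i^j$ are identified with the elements $x_i\otimes x^j\in V\otimes V^*\cong\mathrm{End}(V)$. For any $\varepsilon_1,\varepsilon_2,\varepsilon_3,\varepsilon_4\in\{1,-1\}$ the system of relations $$R^{\varepsilon_1}L_1R^{\varepsilon_2}L_1-L_1R^{\varepsilon_3}L_1R^{\varepsilon_4}=0,\qquad L_1=L\otimes I,$$ is admissible.
   Context: $V$ is a finite-dimensional vector space over $\mathbb{K}=\mathbb{R}$ or $\mathbb{C}$ with basis $\{x_i\}$; $V^*$ is its dual with dual basis $\{x^j\}$, $\langle x_i,x^j\rangle=\delta_i^j$. A Hecke symmetry is an invertible operator $R$ on $V^{\otimes2}$ with $R_{12}R_{23}R_{12}=R_{23}R_{12}R_{23}$ ($R_{12}=R\otimes I$, $R_{23}=I\otimes R$) and $(R-qI)(R+q^{-1}I)=0$, where $q$ is generic (in particular $n_q=\frac{q^n-q^{-n}}{q-q^{-1}}\neq0$ for all integers $n\ge1$). $R$ is skew-invertible if there is $\Psi\in\mathrm{End}(V^{\otimes2})$ with $\mathrm{Tr}_{(2)}R_{12}\Psi_{23}=P_{13}=\mathrm{Tr}_{(2)}\Psi_{12}R_{23}$, $P$ being the flip. Comodule structure. Consider the bialgebra generated by entries of matrices $T=\|t_i^j\|$ and $S=\|s_i^j\|$, with $RT_1T_2=T_1T_2R$ ($T_1=T\otimes I$, $T_2=I\otimes T$), $TS=ST=I$, and coproduct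 $\Delta(t_i^j)=t_i^k\otimes t_k^j$, $\Delta(s_i^j)=s_k^j\otimes s_i^k$ (the RTT algebra completed by the entries $s_i^j$ of the inverse matrix of $T$). It coacts by $x_i\mapsto t_i^k\otimes x_k$, $x^j\mapsto s_k^j\otimes x^k$, hence on $V\otimes V^*$ by $l_i^j\mapsto t_i^ks_p^j\otimes l_k^p$ (symbolically $L\mapsto TLS$, entries of $L$ commuting with those of $T$ and $S$), and multiplicatively on tensor products. Summation over repeated indices is assumed. Category $SW(V)$. Its objects are the spaces $V_\lambda\subset V^{\otimes k}$, $V^*_\mu\subset (V^* )^{\otimes k}$ (images of the projectors obtained from primitive idempotents of the Hecke algebra, for partitions $\lambda$, $\mu$, in the representation defined by $R$), their tensor products, and direct sums of these. In particular, $\mathrm{End}(V)\cong V\otimes V^*$ and $\mathrm{End}(V)^{\otimes2}$ are objects. A linear map $\beta:U_1\to U_2$ between objects is a morphism iff it commutes with the coactions on $U_1$ and $U_2$ of the bialgebra generated by the entries of $T$ and $S$, that is, the coactions induced by $x_i\mapsto t_i^k\otimes x_k$ on $V$ and $x^j\mapsto s_k^j\otimes x^k$ on $V^*$ (extended multiplicatively to tensor products, restricted to the subspaces $V_\lambda$, $V^*_\mu$, and extended to direct sums). Admissible relations. Let $U,W$ be objects of $SW(V)$ with $W\subset T(U)$ a subspace of the tensor algebra of $U$, and let $\beta:W\to W$ be a morphism. The relations $\beta(W)=0$ are called admissible, and the algebra $T(U)/\langle\beta(W)\rangle$ (quotient by the two-sided ideal generated by $\beta(W)$) is called braided. Here $U=\mathrm{End}(V)$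 and $W=\mathrm{End}(V)^{\otimes2}$, so admissibility of the given system means that the linear span in $\mathrm{End}(V)^{\otimes 2}$ of the entries of its left-hand side (with products of entries of $L$ understood as tensor products) equals $\beta(\mathrm{End}(V)^{\otimes2})$ for some morphism $\beta$ of $\mathrm{End}(V)^{\otimes2}$ to itself. *)

theory Defs
  imports "HOL-Analysis.Analysis" "HOL-Library.Poly_Mapping"
begin

section \<open>Free associative algebras and two-sided ideals\<close>

datatype 'g word = Word (letters: "'g list")

instantiation word :: (type) monoid_add
begin

definition zero_word :: "'g word" where "zero_word = Word []"

definition plus_word :: "'g word \<Rightarrow> 'g word \<Rightarrow> 'g word"
  where "plus_word u v = Word (letters u @ letters v)"

instance
  by standard (simp_all add: zero_word_def plus_word_def)

end

text \<open>The free unital algebra on \<open>'g\<close> is the monoid algebra of the words over \<open>'g\<close>; its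
  product is the convolution product of \<open>poly_mapping\<close>, noncommutative here. It is also the
  tensor algebra of the vector space with basis \<open>'g\<close>, words being tensor products.\<close>

type_synonym ('g, 'k) free_alg = "'g word \<Rightarrow>\<^sub>0 'k"

definition gen :: "'g \<Rightarrow> ('g, 'k::ring_1) free_alg"
  where "gen g = Poly_Mapping.single (Word [g]) 1"

definition scal :: "'k \<Rightarrow> ('g, 'k::ring_1) free_alg"
  where "scal c = Poly_Mapping.single 0 c"

definition fscale :: "'k \<Rightarrow> ('g, 'k::ring_1) free_alg \<Rightarrow> ('g, 'k) free_alg"
  where "fscale c p = scal c * p"

lemma vector_space_fscale: "vector_space (fscale :: 'k::field \<Rightarrow> ('g, 'k) free_alg \<Rightarrow> _)"
proof
  fix a b :: 'k and x y :: "('g, 'k) free_alg"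
  show "fscale a (x + y) = fscale a x + fscale a y"
    by (simp add: fscale_def distrib_left)
  show "fscale (a + b) x = fscale a x + fscale b x"
    by (simp add: fscale_def scal_def Poly_Mapping.single_add distrib_right)
  show "fscale a (fscale b x) = fscale (a * b) x"
    by (simp add: fscale_def scal_def mult.assoc[symmetric] Poly_Mapping.mult_single)
  show "fscale 1 x = x"
    by (simp add: fscale_def scal_def)
qed

inductive_set two_sided_ideal :: "'a::ring_1 set \<Rightarrow> 'a set" for X :: "'a set" where
  zero: "0 \<in> two_sided_ideal X"
| base: "x \<in> X \<Longrightarrow> x \<in> two_sided_ideal X"
| add: "a \<in> two_sided_ideal X \<Longrightarrow> b \<in> two_sided_ideal X \<Longrightarrow> a + b \<in> two_sided_ideal X"
| mult_left: "a \<in> two_sided_ideal X \<Longrightarrow> c * a \<in> two_sided_ideal X"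
| mult_right: "a \<in> two_sided_ideal X \<Longrightarrow> a * c \<in> two_sided_ideal X"


section \<open>Matrices\<close>

text \<open>Convention: \<open>V\<close> has a basis \<open>x\<^sub>i\<close> indexed by the finite type \<open>'n\<close>. In all matrices lower
  indices label rows and upper indices label columns: an operator \<open>A\<close> on \<open>V\<close> is the matrix with
  \<open>A x\<^sub>i = \<Sum>j. A $ i $ j x\<^sub>j\<close>, and \<open>R (x\<^sub>i \<otimes> x\<^sub>j) = \<Sum>k l. R $ (i,j) $ (k,l) x\<^sub>k \<otimes> x\<^sub>l\<close>. Composition
  of operators is then the matrix product in the opposite order; the braid and Hecke relations and
  skew-invertibility do not depend on this order. The definitions
  make sense over any field. To have the real or the complex numbers as ground field, use the class
  \<open>real_normed_field\<close>: by the Gelfand-Mazur theorem these are its only instances up to isomorphism.\<close>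

definition kron ::
    "'a::semiring_1^'n::finite^'n \<Rightarrow> 'a^'m::finite^'m \<Rightarrow> 'a^('n \<times> 'm)^('n \<times> 'm)"
  where "kron A B = (\<chi> p r. A $ fst p $ fst r * B $ snd p $ snd r)"

definition emb12 :: "'k::semiring_1^('n::finite \<times> 'n)^('n \<times> 'n) \<Rightarrow> 'k^('n \<times> 'n \<times> 'n)^('n \<times> 'n \<times> 'n)"
  where "emb12 M = (\<chi> p r. case (p, r) of ((i, j, k), (a, b, c)) \<Rightarrow>
           if k = c then M $ (i, j) $ (a, b) else 0)"

definition emb23 :: "'k::semiring_1^('n::finite \<times> 'n)^('n \<times> 'n) \<Rightarrow> 'k^('n \<times> 'n \<times> 'n)^('n \<times> 'n \<times> 'n)"
  where "emb23 M = (\<chi> p r. case (p, r) of ((i, j, k), (a, b, c)) \<Rightarrow>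
           if i = a then M $ (j, k) $ (b, c) else 0)"

text \<open>The partial trace over the second factor; factors 1 and 3 of the result are indexed by
  pairs.\<close>

definition trace2 :: "'k::semiring_1^('n::finite \<times> 'n \<times> 'n)^('n \<times> 'n \<times> 'n) \<Rightarrow> 'k^('n \<times> 'n)^('n \<times> 'n)"
  where "trace2 X = (\<chi> p r. case (p, r) of ((i, k), (a, c)) \<Rightarrow>
           \<Sum>j\<in>UNIV. X $ (i, j, k) $ (a, j, c))"

definition flip :: "'k::semiring_1^('n::finite \<times> 'n)^('n \<times> 'n)"
  where "flip = (\<chi> p r. if r = prod.swap p then 1 else 0)"


section \<open>Skew-invertible Hecke symmetries\<close>

definition q_int :: "nat \<Rightarrow> 'k::field \<Rightarrow> 'k"
  where "q_int n q = (q ^ n - inverse q ^ n) / (q - inverse q)"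

text \<open>The conditions \<open>q \<noteq> 0\<close> and \<open>q\<^sup>2 \<noteq> 1\<close> say that \<open>q_int\<close> is meaningful.\<close>

definition generic :: "'k::field \<Rightarrow> bool"
  where "generic q \<longleftrightarrow> q \<noteq> 0 \<and> q\<^sup>2 \<noteq> 1 \<and> (\<forall>n\<ge>1. q_int n q \<noteq> 0)"

definition Hecke_symmetry :: "'k::field \<Rightarrow> 'k^('n::finite \<times> 'n)^('n \<times> 'n) \<Rightarrow> bool"
  where "Hecke_symmetry q R \<longleftrightarrow>
    generic q \<and> invertible R \<and>
    emb12 R ** emb23 R ** emb12 R = emb23 R ** emb12 R ** emb23 R \<and>
    (R - mat q) ** (R + mat (inverse q)) = 0"

definition skew_invertible :: "'k::field^('n::finite \<times> 'n)^('n \<times> 'n) \<Rightarrow> bool"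
  where "skew_invertible R \<longleftrightarrow>
    (\<exists>\<Psi>. trace2 (emb12 R ** emb23 \<Psi>) = flip \<and> trace2 (emb12 \<Psi> ** emb23 R) = flip)"


section \<open>The RTT algebra with inverse generators\<close>

datatype 'n rtt_gen = T_gen 'n 'n | S_gen 'n 'n

type_synonym ('n, 'k) rtt_free = "('n rtt_gen, 'k) free_alg"

definition T_mat :: "('n::finite, 'k::ring_1) rtt_free^'n^'n"
  where "T_mat = (\<chi> i j. gen (T_gen i j))"

definition S_mat :: "('n::finite, 'k::ring_1) rtt_free^'n^'n"
  where "S_mat = (\<chi> i j. gen (S_gen i j))"

definition entries :: "'a^'m::finite^'n::finite \<Rightarrow> 'a set"
  where "entries M = {M $ i $ j | i j. True}"

definition rtt_relations :: "'k::field^('n \<times> 'n)^('n::finite \<times> 'n) \<Rightarrow> ('n, 'k) rtt_free set"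
  where "rtt_relations R =
    (let R' = map_matrix scal R; T\<^sub>1 = kron T_mat (mat 1); T\<^sub>2 = kron (mat 1) T_mat
     in entries (R' ** T\<^sub>1 ** T\<^sub>2 - T\<^sub>1 ** T\<^sub>2 ** R')
        \<union> entries (T_mat ** S_mat - mat 1) \<union> entries (S_mat ** T_mat - mat 1))"

text \<open>Elements of the RTT algebra are represented by elements of the free algebra on the entries of
  \<open>T\<close> and \<open>S\<close>; equality in the RTT algebra is the following congruence.\<close>

definition rtt_eq ::
    "'k::field^('n \<times> 'n)^('n::finite \<times> 'n) \<Rightarrow> ('n, 'k) rtt_free \<Rightarrow> ('n, 'k) rtt_free \<Rightarrow> bool"
  where "rtt_eq R a b \<longleftrightarrow> a - b \<in> two_sided_ideal (rtt_relations R)"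


section \<open>Coactions and morphisms\<close>

text \<open>A coaction \<open>\<delta>\<close> on a space \<open>U\<close> with basis \<open>e\<^sub>i\<close> (\<open>i\<close> in \<open>'i\<close>) is given by its coefficient
  matrix \<open>C\<close>, where \<open>\<delta> e\<^sub>i = \<Sum>k. C $ i $ k \<otimes> e\<^sub>k\<close>. An element \<open>\<Sum>k. a\<^sub>k \<otimes> e\<^sub>k\<close> of the tensor
  product of the RTT algebra with \<open>U\<close> is the vector of its coefficients \<open>a\<^sub>k\<close>. The coefficient
  matrix of the multiplicative coaction on a tensor product is the Kronecker product, with the
  factors in the RTT algebra multiplied from left to right.\<close>

definition coact_V :: "('n::finite, 'k::ring_1) rtt_free^'n^'n"
  where "coact_V = T_mat"

definition coact_V_dual :: "('n::finite, 'k::ring_1) rtt_free^'n^'n"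
  where "coact_V_dual = transpose S_mat"

definition coact_End :: "('n::finite, 'k::ring_1) rtt_free^('n \<times> 'n)^('n \<times> 'n)"
  where "coact_End = kron coact_V coact_V_dual"

definition coact_End2 ::
    "('n::finite, 'k::ring_1) rtt_free^(('n \<times> 'n) \<times> ('n \<times> 'n))^(('n \<times> 'n) \<times> ('n \<times> 'n))"
  where "coact_End2 = kron coact_End coact_End"

definition coaction ::
    "('n::finite, 'k::ring_1) rtt_free^'i^'i \<Rightarrow> 'k^'i \<Rightarrow> ('n, 'k) rtt_free^'i"
  where "coaction C v = (\<chi> k. \<Sum>i\<in>UNIV. fscale (v $ i) (C $ i $ k))"

text \<open>The map \<open>id \<otimes> \<beta>\<close>.\<close>

definition id_tensor ::
    "('k::ring_1^'i \<Rightarrow> 'k^'j) \<Rightarrow> ('n::finite, 'k) rtt_free^'i \<Rightarrow> ('n, 'k) rtt_free^'j"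
  where "id_tensor \<beta> a = (\<chi> m. \<Sum>k\<in>UNIV. fscale (\<beta> (axis k 1) $ m) (a $ k))"

definition comodule_morphism ::
    "'k::field^('n \<times> 'n)^('n::finite \<times> 'n) \<Rightarrow> ('n, 'k) rtt_free^'i^'i \<Rightarrow> ('n, 'k) rtt_free^'j^'j
      \<Rightarrow> ('k^'i \<Rightarrow> 'k^'j) \<Rightarrow> bool"
  where "comodule_morphism R C D \<beta> \<longleftrightarrow>
    Vector_Spaces.linear (*s) (*s) \<beta> \<and>
    (\<forall>v m. rtt_eq R (coaction D (\<beta> v) $ m) (id_tensor \<beta> (coaction C v) $ m))"


section \<open>Admissible quadratic relations on \<open>End(V)\<close>\<close>

text \<open>The generator \<open>(i, j)\<close> of the tensor algebra of \<open>End(V)\<close> is \<open>l\<^sub>i\<^sup>j = x\<^sub>i \<otimes> x\<^sup>j\<close>.\<close>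

type_synonym ('n, 'k) tensor_End = "('n \<times> 'n, 'k) free_alg"

definition L_mat :: "('n::finite, 'k::ring_1) tensor_End^'n^'n"
  where "L_mat = (\<chi> i j. gen (i, j))"

text \<open>The embedding of \<open>End(V)\<close> tensor \<open>End(V)\<close> as the quadratic part of the tensor algebra.\<close>

definition quad :: "'k::ring_1^(('n \<times> 'n) \<times> ('n::finite \<times> 'n)) \<Rightarrow> ('n, 'k) tensor_End"
  where "quad v = (\<Sum>(a, b)\<in>UNIV. fscale (v $ (a, b)) (gen a * gen b))"

definition admissible ::
    "'k::field^('n \<times> 'n)^('n::finite \<times> 'n) \<Rightarrow> ('n, 'k) tensor_End set \<Rightarrow> bool"
  where "admissible R X \<longleftrightarrow>
    (\<exists>\<beta>. comodule_morphism R coact_End2 coact_End2 \<beta> \<and>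
         module.span fscale X = quad ` range \<beta>)"

definition sign_power :: "'k::field^'m^'m \<Rightarrow> int \<Rightarrow> 'k^'m^'m"
  where "sign_power R e = (if e = - 1 then matrix_inv R else R)"

definition L_system ::
    "'k::field^('n \<times> 'n)^('n::finite \<times> 'n) \<Rightarrow> int \<Rightarrow> int \<Rightarrow> int \<Rightarrow> int
      \<Rightarrow> ('n, 'k) tensor_End^('n \<times> 'n)^('n \<times> 'n)"
  where "L_system R e\<^sub>1 e\<^sub>2 e\<^sub>3 e\<^sub>4 =
    (let L\<^sub>1 = kron L_mat (mat 1); R' = (\<lambda>e. map_matrix scal (sign_power R e))
     in R' e\<^sub>1 ** L\<^sub>1 ** R' e\<^sub>2 ** L\<^sub>1 - L\<^sub>1 ** R' e\<^sub>3 ** L\<^sub>1 ** R' e\<^sub>4)"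

end

theory Submission
  imports Defs
begin

text \<open>In the RTT algebra the relation \<open>R T\<^sub>1 T\<^sub>2 = T\<^sub>1 T\<^sub>2 R\<close> gives \<open>S\<^sub>1 M T\<^sub>1 = T\<^sub>2 M S\<^sub>2\<close> for \<open>M\<close> equal to
  \<open>R\<close> or its inverse, so the coaction \<open>L \<mapsto> T L S\<close> turns \<open>L\<^sub>1 M L\<^sub>1\<close> into
  \<open>T\<^sub>1 T\<^sub>2 (L\<^sub>1 M L\<^sub>1) S\<^sub>2 S\<^sub>1\<close>. Multiplication by \<open>R\<close> or its inverse on either side preserves this
  transformation law, hence the matrix of the relations obeys it as well. Skew-invertibility of \<open>R\<close>
  says that the entries of \<open>L\<^sub>1 R L\<^sub>1\<close> form a basis of \<open>End(V) \<otimes> End(V)\<close>. Since they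
  transform in the same way as the relations, sending the entries of \<open>L\<^sub>1 R L\<^sub>1\<close> to the
  corresponding entries of the relations defines the required morphism.\<close>

section \<open>Scalars and Kronecker products\<close>

lemma sum_UNIV_prod:
  "(\<Sum>p\<in>(UNIV :: ('a::finite \<times> 'b::finite) set). f p) = (\<Sum>a\<in>UNIV. \<Sum>b\<in>UNIV. f (a, b))"
  by (simp add: sum.cartesian_product)

lemma sum_if_conj:
  "(\<Sum>x\<in>A. if P \<and> Q x then f x else 0) = (if P then \<Sum>x\<in>A. if Q x then f x else 0 else 0)"
  by simp

lemma sum_if_const: "(\<Sum>x\<in>A. if P then f x else 0) = (if P then sum f A else 0)"
  by simp

lemma mat_1_commute: "mat 1 $ i $ j * x = x * (mat 1 :: 'a::semiring_1^'n^'n) $ i $ j"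
  by (simp add: mat_def)

lemma scal_0 [simp]: "scal 0 = 0"
  by (simp add: scal_def)

lemma scal_1 [simp]: "scal 1 = 1"
  by (simp add: scal_def)

lemma scal_add: "scal (a + b) = scal a + scal b"
  by (simp add: scal_def Poly_Mapping.single_add)

lemma scal_diff: "scal (a - b) = scal a - scal b"
  by (simp add: scal_def Poly_Mapping.single_diff)

lemma scal_mult: "scal (a * b) = scal a * scal b"
  by (simp add: scal_def Poly_Mapping.mult_single)

lemma scal_sum: "scal (sum f A) = (\<Sum>x\<in>A. scal (f x))"
  by (induction A rule: infinite_finite_induct) (simp_all add: scal_add)

text \<open>Scalars are central: they are multiples of the empty word, which is neutral on both
  sides, and the ground ring is commutative. The induction adds one monomial at a time.\<close>

lemma scal_commute:
  fixes p :: "('g, 'k::comm_ring_1) free_alg"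
  shows "p * scal c = scal c * p"
proof (induction p rule: Poly_Mapping.update_induct)
  case const
  then show ?case by simp
next
  case (update f a b)
  have "Poly_Mapping.update a b f = f + Poly_Mapping.single a b"
    using update(1)
    by (intro poly_mapping_eqI)
      (auto simp: lookup_update lookup_add lookup_single when_def in_keys_iff)
  then show ?case
    using update(3)
    by (simp add: distrib_left distrib_right scal_def Poly_Mapping.mult_single mult.commute)
qed

lemma scal_left_commute:
  fixes x y :: "('g, 'k::comm_ring_1) free_alg"
  shows "x * (scal c * y) = scal c * (x * y)"
  by (metis mult.assoc scal_commute)

lemma scal_if: "scal (if P then a else 0) = (if P then scal a else 0)"
  by simp

lemmas delta_simps = mult_delta_left mult_delta_right scal_if sum_if_conj sum_if_const

lemma map_matrix_scal_mult:
  "map_matrix scal (A ** B) = map_matrix scal A ** map_matrix scal B"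
  by (simp add: vec_eq_iff matrix_matrix_mult_def scal_sum scal_mult)

lemma map_matrix_scal_mat_1 [simp]: "map_matrix scal (mat 1) = mat 1"
  by (simp add: vec_eq_iff mat_def)

lemma matrix_sub_ldistrib: "A ** (B - C) = A ** B - A ** (C :: 'a::ring_1^_^_)"
  by (simp add: vec_eq_iff matrix_matrix_mult_def right_diff_distrib sum_subtractf)

lemma matrix_sub_rdistrib: "(A - B) ** C = A ** C - B ** (C :: 'a::ring_1^_^_)"
  by (simp add: vec_eq_iff matrix_matrix_mult_def left_diff_distrib sum_subtractf)

lemma map_matrix_scal_diff: "map_matrix scal (A - B) = map_matrix scal A - map_matrix scal B"
  by (simp add: vec_eq_iff scal_diff)

section \<open>Kronecker products over a noncommutative ring\<close>

lemma kron_nth [simp]: "kron A B $ (i, j) $ (k, l) = A $ i $ k * B $ j $ l"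
  by (simp add: kron_def)

text \<open>The mixed product rule needs the entries of \<open>B\<close> to move past those of
  \<open>C\<close>. Over the free algebra this is available when one of the two is scalar.\<close>

lemma kron_mult:
  fixes A C :: "'a::semiring_1^'n::finite^'n" and B D :: "'a^'m::finite^'m"
  assumes "\<And>i j k l. B $ i $ j * C $ k $ l = C $ k $ l * B $ i $ j"
  shows "kron A B ** kron C D = kron (A ** C) (B ** D)"
proof -
  have "A $ i $ a * B $ j $ b * (C $ a $ k * D $ b $ l) = A $ i $ a * C $ a $ k * (B $ j $ b * D $ b $ l)"
    for i j k l a b
    using assms[of j b a k] by (metis mult.assoc)
  then show ?thesis
    by (simp add: vec_eq_iff matrix_matrix_mult_def sum_UNIV_prod sum_product)
qed

lemma kron_mat_1: "kron (mat 1) (mat 1) = mat 1"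
  by (auto simp: vec_eq_iff mat_def kron_def)

lemma kron_mult_left_1: "kron (A ** C) (mat 1) = kron A (mat 1) ** kron C (mat 1)"
  by (subst kron_mult) (auto intro: mat_1_commute mat_1_commute[symmetric])

lemma kron_mult_right_1: "kron (mat 1) (B ** D) = kron (mat 1) B ** kron (mat 1) D"
  by (subst kron_mult) (auto intro: mat_1_commute mat_1_commute[symmetric])

lemma kron_left_1_mult_nth:
  "(kron A (mat 1) ** X) $ (i, j) $ c = (\<Sum>a\<in>UNIV. A $ i $ a * X $ (a, j) $ c)"
  by (simp add: matrix_matrix_mult_def sum_UNIV_prod mat_def delta_simps cong: if_cong)

lemma kron_right_1_mult_nth:
  "(kron (mat 1) B ** X) $ (i, j) $ c = (\<Sum>b\<in>UNIV. B $ j $ b * X $ (i, b) $ c)"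
  by (simp add: matrix_matrix_mult_def sum_UNIV_prod mat_def delta_simps cong: if_cong)

lemma mult_kron_left_1_nth:
  "(X ** kron A (mat 1)) $ r $ (k, l) = (\<Sum>a\<in>UNIV. X $ r $ (a, l) * A $ a $ k)"
  by (simp add: matrix_matrix_mult_def sum_UNIV_prod mat_def delta_simps cong: if_cong)

lemma mult_kron_right_1_nth:
  "(X ** kron (mat 1) B) $ r $ (k, l) = (\<Sum>b\<in>UNIV. X $ r $ (k, b) * B $ b $ l)"
  by (simp add: matrix_matrix_mult_def sum_UNIV_prod mat_def delta_simps cong: if_cong)


section \<open>Congruence of matrices over the RTT algebra\<close>

lemma rtt_eq_refl: "rtt_eq R a a"
  by (simp add: rtt_eq_def two_sided_ideal.zero)

lemma rtt_eq_sym: "rtt_eq R a b \<Longrightarrow> rtt_eq R b a"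
  using two_sided_ideal.mult_left[of "a - b" "rtt_relations R" "- 1"] by (simp add: rtt_eq_def)

lemma rtt_eq_trans: "rtt_eq R a b \<Longrightarrow> rtt_eq R b c \<Longrightarrow> rtt_eq R a c"
  using two_sided_ideal.add[of "a - b" "rtt_relations R" "b - c"] by (simp add: rtt_eq_def)

lemma rtt_eq_add: "rtt_eq R a b \<Longrightarrow> rtt_eq R c d \<Longrightarrow> rtt_eq R (a + c) (b + d)"
  using two_sided_ideal.add[of "a - b" "rtt_relations R" "c - d"]
  by (simp add: rtt_eq_def add_diff_add)

lemma rtt_eq_mult_left: "rtt_eq R a b \<Longrightarrow> rtt_eq R (c * a) (c * b)"
  using two_sided_ideal.mult_left[of "a - b" "rtt_relations R" c]
  by (simp add: rtt_eq_def right_diff_distrib)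

lemma rtt_eq_mult_right: "rtt_eq R a b \<Longrightarrow> rtt_eq R (a * c) (b * c)"
  using two_sided_ideal.mult_right[of "a - b" "rtt_relations R" c]
  by (simp add: rtt_eq_def left_diff_distrib)

lemma rtt_eq_diff: "rtt_eq R a b \<Longrightarrow> rtt_eq R c d \<Longrightarrow> rtt_eq R (a - c) (b - d)"
  using rtt_eq_add[OF _ rtt_eq_mult_left[of R c d "- 1"]] by simp

lemma rtt_eq_sum: "(\<And>x. x \<in> A \<Longrightarrow> rtt_eq R (f x) (g x)) \<Longrightarrow> rtt_eq R (sum f A) (sum g A)"
  by (induction A rule: infinite_finite_induct) (simp_all add: rtt_eq_refl rtt_eq_add)

text \<open>The quotient algebra is never formed: matrices stay over the free algebra and are
  compared entrywise modulo the ideal.\<close>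

definition rtt_meq ::
    "'k::field^('n \<times> 'n)^('n::finite \<times> 'n) \<Rightarrow> ('n, 'k) rtt_free^'i^'j \<Rightarrow> ('n, 'k) rtt_free^'i^'j \<Rightarrow> bool"
  where "rtt_meq R A B \<longleftrightarrow> (\<forall>i j. rtt_eq R (A $ i $ j) (B $ i $ j))"

lemma rtt_meq_refl: "rtt_meq R A A"
  by (simp add: rtt_meq_def rtt_eq_refl)

lemma rtt_meq_sym: "rtt_meq R A B \<Longrightarrow> rtt_meq R B A"
  by (simp add: rtt_meq_def rtt_eq_sym)

lemma rtt_meq_trans [trans]: "rtt_meq R A B \<Longrightarrow> rtt_meq R B C \<Longrightarrow> rtt_meq R A C"
  unfolding rtt_meq_def by (blast intro: rtt_eq_trans)

lemma rtt_meq_diff: "rtt_meq R A B \<Longrightarrow> rtt_meq R C D \<Longrightarrow> rtt_meq R (A - C) (B - D)"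
  by (simp add: rtt_meq_def rtt_eq_diff)

lemma rtt_meq_mult_left: "rtt_meq R A B \<Longrightarrow> rtt_meq R (C ** A) (C ** B)"
  by (auto simp: rtt_meq_def matrix_matrix_mult_def intro!: rtt_eq_sum rtt_eq_mult_left)

lemma rtt_meq_mult_right: "rtt_meq R A B \<Longrightarrow> rtt_meq R (A ** C) (B ** C)"
  by (auto simp: rtt_meq_def matrix_matrix_mult_def intro!: rtt_eq_sum rtt_eq_mult_right)

lemma rtt_meq_kron_left: "rtt_meq R A B \<Longrightarrow> rtt_meq R (kron A C) (kron B C)"
  by (auto simp: rtt_meq_def intro!: rtt_eq_mult_right)

lemma rtt_meq_kron_right: "rtt_meq R A B \<Longrightarrow> rtt_meq R (kron C A) (kron C B)"
  by (auto simp: rtt_meq_def intro!: rtt_eq_mult_left)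

lemma rtt_meq_entries:
  assumes "entries (A - B) \<subseteq> rtt_relations R"
  shows "rtt_meq R A B"
  using assms by (auto simp: rtt_meq_def rtt_eq_def entries_def intro!: two_sided_ideal.base)

lemma rtt_meq_mult_cancel_left:
  assumes "rtt_meq R (A ** B) (mat 1)"
  shows "rtt_meq R (A ** (B ** C)) C"
  using rtt_meq_mult_right[OF assms, of C] by (simp add: matrix_mul_assoc)

lemma rtt_meq_mult_cancel_right:
  assumes "rtt_meq R (A ** B) (mat 1)"
  shows "rtt_meq R (C ** A ** B) C"
  using rtt_meq_mult_left[OF assms, of C] by (simp add: matrix_mul_assoc)

text \<open>What commutes with \<open>A\<close> commutes with its inverse: BM = BMAB = BAMB = MB. It
  serves once to invert R and once to pass from T_1T_2 to S_2S_1.\<close>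

lemma rtt_meq_inverse_commute:
  assumes "rtt_meq R (M ** A) (A ** M)" and "rtt_meq R (A ** B) (mat 1)" and "rtt_meq R (B ** A) (mat 1)"
  shows "rtt_meq R (B ** M) (M ** B)"
proof -
  have "rtt_meq R (B ** M) (B ** M ** A ** B)"
    using rtt_meq_mult_cancel_right[OF assms(2)] by (rule rtt_meq_sym)
  also have "rtt_meq R (B ** M ** A ** B) (B ** (A ** M) ** B)"
    using rtt_meq_mult_right[OF rtt_meq_mult_left[OF assms(1)]] by (simp add: matrix_mul_assoc)
  also have "rtt_meq R (B ** (A ** M) ** B) (M ** B)"
    using rtt_meq_mult_right[OF rtt_meq_mult_cancel_left[OF assms(3)]] .
  finally show ?thesis .
qed


section \<open>Intertwiners\<close>

abbreviation "T\<^sub>1 \<equiv> kron T_mat (mat 1)"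
abbreviation "T\<^sub>2 \<equiv> kron (mat 1) T_mat"
abbreviation "S\<^sub>1 \<equiv> kron S_mat (mat 1)"
abbreviation "S\<^sub>2 \<equiv> kron (mat 1) S_mat"

text \<open>T_1T_2 is the coefficient matrix of the coaction on the tensor square of V, so such an
  \<open>M\<close> is a comodule endomorphism of that square.\<close>

definition rtt_commuting ::
    "'k::field^('n \<times> 'n)^('n::finite \<times> 'n) \<Rightarrow> 'k^('n \<times> 'n)^('n \<times> 'n) \<Rightarrow> bool"
  where "rtt_commuting R M \<longleftrightarrow>
    rtt_meq R (map_matrix scal M ** (T\<^sub>1 ** T\<^sub>2)) (T\<^sub>1 ** T\<^sub>2 ** map_matrix scal M)"

section \<open>Inverses of the coefficient matrices\<close>

lemma rtt_TS: "rtt_meq R (T_mat ** S_mat) (mat 1)"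
  by (rule rtt_meq_entries) (auto simp: rtt_relations_def Let_def)

lemma rtt_ST: "rtt_meq R (S_mat ** T_mat) (mat 1)"
  by (rule rtt_meq_entries) (auto simp: rtt_relations_def Let_def)

lemma rtt_T1S1: "rtt_meq R (T\<^sub>1 ** S\<^sub>1) (mat 1)"
  using rtt_meq_kron_left[OF rtt_TS, of R "mat 1"] by (simp add: kron_mult_left_1 kron_mat_1)

lemma rtt_S1T1: "rtt_meq R (S\<^sub>1 ** T\<^sub>1) (mat 1)"
  using rtt_meq_kron_left[OF rtt_ST, of R "mat 1"] by (simp add: kron_mult_left_1 kron_mat_1)

lemma rtt_T2S2: "rtt_meq R (T\<^sub>2 ** S\<^sub>2) (mat 1)"
  using rtt_meq_kron_right[OF rtt_TS, of R "mat 1"] by (simp add: kron_mult_right_1 kron_mat_1)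

lemma rtt_S2T2: "rtt_meq R (S\<^sub>2 ** T\<^sub>2) (mat 1)"
  using rtt_meq_kron_right[OF rtt_ST, of R "mat 1"] by (simp add: kron_mult_right_1 kron_mat_1)

lemma rtt_T1T2S2S1: "rtt_meq R (T\<^sub>1 ** T\<^sub>2 ** (S\<^sub>2 ** S\<^sub>1)) (mat 1)"
  using rtt_meq_trans[OF rtt_meq_mult_right[OF rtt_meq_mult_cancel_right[OF rtt_T2S2]] rtt_T1S1]
  by (simp add: matrix_mul_assoc)

lemma rtt_S2S1T1T2: "rtt_meq R (S\<^sub>2 ** S\<^sub>1 ** (T\<^sub>1 ** T\<^sub>2)) (mat 1)"
  using rtt_meq_trans[OF rtt_meq_mult_right[OF rtt_meq_mult_cancel_right[OF rtt_S1T1]] rtt_S2T2]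
  by (simp add: matrix_mul_assoc)

lemma rtt_commuting_R: "rtt_commuting R R"
  unfolding rtt_commuting_def
  by (rule rtt_meq_entries) (auto simp: rtt_relations_def Let_def matrix_mul_assoc)

lemma rtt_commuting_sign_power:
  assumes "invertible R"
  shows "rtt_commuting R (sign_power R e)"
proof -
  have inv: "R ** matrix_inv R = mat 1" "matrix_inv R ** R = mat 1"
    using assms someI_ex[of "\<lambda>A. R ** A = mat 1 \<and> A ** R = mat 1"]
    by (auto simp: invertible_def matrix_inv_def)
  have "map_matrix scal R ** map_matrix scal (matrix_inv R) = (mat 1 :: ('b, 'a) rtt_free^_^_)"
    and "map_matrix scal (matrix_inv R) ** map_matrix scal R = (mat 1 :: ('b, 'a) rtt_free^_^_)"
    by (simp_all flip: map_matrix_scal_mult add: inv)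
  then have "rtt_commuting R (matrix_inv R)"
    \<comment> \<open>Here T_1T_2 is the commuting matrix and R the one being inverted.\<close>
    using rtt_meq_inverse_commute[OF rtt_meq_sym[OF rtt_commuting_R[unfolded rtt_commuting_def]],
        of R "map_matrix scal (matrix_inv R)"]
    by (simp add: rtt_commuting_def rtt_meq_refl)
  then show ?thesis
    by (simp add: sign_power_def rtt_commuting_R)
qed

text \<open>Multiply M T_1T_2 = T_1T_2 M by S_1 on the left and by S_2 on the right.\<close>

lemma S1_M_T1:
  assumes "rtt_commuting R M"
  shows "rtt_meq R (S\<^sub>1 ** map_matrix scal M ** T\<^sub>1) (T\<^sub>2 ** map_matrix scal M ** S\<^sub>2)"
proof -
  let ?M = "map_matrix scal M"
  have "rtt_meq R (S\<^sub>1 ** ?M ** T\<^sub>1) (S\<^sub>1 ** ?M ** T\<^sub>1 ** T\<^sub>2 ** S\<^sub>2)"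
    by (rule rtt_meq_sym[OF rtt_meq_mult_cancel_right[OF rtt_T2S2]])
  also have "rtt_meq R (S\<^sub>1 ** ?M ** T\<^sub>1 ** T\<^sub>2 ** S\<^sub>2) (S\<^sub>1 ** (T\<^sub>1 ** (T\<^sub>2 ** ?M)) ** S\<^sub>2)"
    using rtt_meq_mult_right[OF rtt_meq_mult_left[OF assms[unfolded rtt_commuting_def]]]
    by (simp add: matrix_mul_assoc)
  also have "rtt_meq R (S\<^sub>1 ** (T\<^sub>1 ** (T\<^sub>2 ** ?M)) ** S\<^sub>2) (T\<^sub>2 ** ?M ** S\<^sub>2)"
    by (rule rtt_meq_mult_right[OF rtt_meq_mult_cancel_left[OF rtt_S1T1]])
  finally show ?thesis .
qed

text \<open>This sum is what the coaction produces between the two factors L_1 of L_1 M L_1.\<close>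

lemma S1_M_T1_nth:
  assumes "rtt_commuting R M"
  shows "rtt_eq R
    (\<Sum>b\<in>UNIV. \<Sum>a\<in>UNIV. S_mat $ a' $ a * scal (M $ (a, j) $ (b, l)) * T_mat $ b $ b')
    (\<Sum>l'\<in>UNIV. \<Sum>j'\<in>UNIV. T_mat $ j $ j' * scal (M $ (a', j') $ (b', l')) * S_mat $ l' $ l)"
  using S1_M_T1[OF assms, unfolded rtt_meq_def, rule_format, of "(a', j)" "(b', l)"]
  by (simp add: mult_kron_left_1_nth mult_kron_right_1_nth kron_left_1_mult_nth
      kron_right_1_mult_nth sum_distrib_right)

text \<open>The entries of a matrix \<open>Z\<close> on \<open>V \<otimes> V\<close> that transforms as \<open>Z \<mapsto> T\<^sub>1T\<^sub>2 Z S\<^sub>2S\<^sub>1\<close> span a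
  comodule with this coefficient matrix; the entry \<open>Z\<^sub>i\<^sub>j\<^sup>k\<^sup>l\<close> has index \<open>((i, j), (k, l))\<close>.\<close>

definition coact_Z ::
    "('n::finite, 'k::ring_1) rtt_free^(('n \<times> 'n) \<times> ('n \<times> 'n))^(('n \<times> 'n) \<times> ('n \<times> 'n))"
  where "coact_Z = kron (T\<^sub>1 ** T\<^sub>2) (transpose (S\<^sub>2 ** S\<^sub>1))"

text \<open>The row with index \<open>((i, j), (k, l))\<close> lists the coefficients of the entry
  \<open>(L\<^sub>1 M L\<^sub>1)\<^sub>i\<^sub>j\<^sup>k\<^sup>l = \<Sum>a b. l\<^sub>i\<^sup>a M\<^sub>a\<^sub>j\<^sup>b\<^sup>l l\<^sub>b\<^sup>k\<close>.\<close>

definition LML_coeff ::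
    "'k::zero^('n \<times> 'n)^('n::finite \<times> 'n) \<Rightarrow> 'k^(('n \<times> 'n) \<times> ('n \<times> 'n))^(('n \<times> 'n) \<times> ('n \<times> 'n))"
  where "LML_coeff M = (\<chi> p c. case (p, c) of (((i, j), (k, l)), ((i', a), (b, k'))) \<Rightarrow>
           if i = i' \<and> k = k' then M $ (a, j) $ (b, l) else 0)"

lemma coact_Z_nth:
  "coact_Z $ ((i, j), (k, l)) $ ((i', j'), (k', l')) =
    T_mat $ i $ i' * T_mat $ j $ j' * (S_mat $ l' $ l * S_mat $ k' $ k)"
proof -
  have "(T\<^sub>1 ** T\<^sub>2 :: ('a, 'b) rtt_free^_^_) $ (i, j) $ (i', j') = T_mat $ i $ i' * T_mat $ j $ j'"
    unfolding kron_left_1_mult_nth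
    by (simp add: mat_def delta_simps cong: if_cong)
  moreover have "(S\<^sub>2 ** S\<^sub>1 :: ('a, 'b) rtt_free^_^_) $ (k', l') $ (k, l) = S_mat $ l' $ l * S_mat $ k' $ k"
    unfolding kron_right_1_mult_nth
    by (simp add: mat_def delta_simps cong: if_cong)
  ultimately show ?thesis
    by (simp add: coact_Z_def transpose_def)
qed

lemma coact_End2_nth:
  "coact_End2 $ ((i, a), (b, k)) $ ((i', a'), (b', k')) =
    T_mat $ i $ i' * S_mat $ a' $ a * (T_mat $ b $ b' * S_mat $ k' $ k)"
  by (simp add: coact_End2_def coact_End_def coact_V_def coact_V_dual_def transpose_def)

text \<open>This is the law L_1 M L_1 -> T_1T_2 (L_1 M L_1) S_2S_1 in coefficients. On both sides an
  outer factor T on the left and an outer factor S on the right split off; the sums that remain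
  inside are the entries of S_1 M T_1 and of T_2 M S_2.\<close>

lemma LML_coeff_intertwines:
  assumes "rtt_commuting R M"
  shows "rtt_meq R (map_matrix scal (LML_coeff M) ** coact_End2)
    (coact_Z ** map_matrix scal (LML_coeff M))"
proof -
  have "rtt_eq R ((map_matrix scal (LML_coeff M) ** coact_End2) $ ((i, j), (k, l)) $ ((i', a'), (b', k')))
    ((coact_Z ** map_matrix scal (LML_coeff M)) $ ((i, j), (k, l)) $ ((i', a'), (b', k')))"
    (is "rtt_eq R ?A ?B") for i j k l i' a' b' k'
  proof -
    have A: "?A = T_mat $ i $ i' *
      (\<Sum>b\<in>UNIV. \<Sum>a\<in>UNIV. S_mat $ a' $ a * scal (M $ (a, j) $ (b, l)) * T_mat $ b $ b') *
      S_mat $ k' $ k"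
    proof -
      have "?A = (\<Sum>a\<in>UNIV. \<Sum>b\<in>UNIV. scal (M $ (a, j) $ (b, l)) *
          (T_mat $ i $ i' * S_mat $ a' $ a * (T_mat $ b $ b' * S_mat $ k' $ k)))"
        by (simp add: matrix_matrix_mult_def sum_UNIV_prod LML_coeff_def coact_End2_nth
            delta_simps cong: if_cong)
      also have "\<dots> = (\<Sum>b\<in>UNIV. \<Sum>a\<in>UNIV. T_mat $ i $ i' *
          (S_mat $ a' $ a * scal (M $ (a, j) $ (b, l)) * T_mat $ b $ b') * S_mat $ k' $ k)"
        by (subst sum.swap) (simp add: mult.assoc scal_commute scal_left_commute)
      finally show ?thesis
        by (simp add: sum_distrib_left sum_distrib_right)
    qed
    have B: "?B = T_mat $ i $ i' *
      (\<Sum>l'\<in>UNIV. \<Sum>j'\<in>UNIV. T_mat $ j $ j' * scal (M $ (a', j') $ (b', l')) * S_mat $ l' $ l) *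
      S_mat $ k' $ k"
    proof -
      have "?B = (\<Sum>j'\<in>UNIV. \<Sum>l'\<in>UNIV. T_mat $ i $ i' * T_mat $ j $ j' *
          (S_mat $ l' $ l * S_mat $ k' $ k) * scal (M $ (a', j') $ (b', l')))"
        by (simp add: matrix_matrix_mult_def sum_UNIV_prod LML_coeff_def coact_Z_nth
            delta_simps cong: if_cong)
      also have "\<dots> = (\<Sum>l'\<in>UNIV. \<Sum>j'\<in>UNIV. T_mat $ i $ i' *
          (T_mat $ j $ j' * scal (M $ (a', j') $ (b', l')) * S_mat $ l' $ l) * S_mat $ k' $ k)"
        by (subst sum.swap) (simp add: mult.assoc scal_commute scal_left_commute)
      finally show ?thesis
        by (simp add: sum_distrib_left sum_distrib_right)
    qed
    show ?thesis
      unfolding A B by (intro rtt_eq_mult_left rtt_eq_mult_right S1_M_T1_nth[OF assms])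
  qed
  then show ?thesis
    by (auto simp: rtt_meq_def)
qed

section \<open>Multiplying a matrix with this transformation law by intertwiners\<close>

lemma map_matrix_scal_kron: "map_matrix scal (kron A B) = kron (map_matrix scal A) (map_matrix scal B)"
  by (simp add: vec_eq_iff scal_mult)

lemma map_matrix_scal_transpose: "map_matrix scal (transpose A) = transpose (map_matrix scal A)"
  by (simp add: vec_eq_iff transpose_def)

text \<open>Left multiplication by \<open>N\<close> acts on the lower index pair, which the coaction
  transforms by T_1T_2 alone.\<close>

lemma coact_Z_left:
  assumes "rtt_commuting R N"
  shows "rtt_meq R (map_matrix scal (kron N (mat 1)) ** coact_Z)
    (coact_Z ** map_matrix scal (kron N (mat 1)))"
proof -
  let ?N = "map_matrix scal N" and ?S = "transpose (S\<^sub>2 ** S\<^sub>1)"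
  have "rtt_meq R (kron (?N ** (T\<^sub>1 ** T\<^sub>2)) ?S) (kron (T\<^sub>1 ** T\<^sub>2 ** ?N) ?S)"
    by (rule rtt_meq_kron_left) (use assms in \<open>simp add: rtt_commuting_def\<close>)
  moreover have "kron ?N (mat 1) ** coact_Z = kron (?N ** (T\<^sub>1 ** T\<^sub>2)) ?S"
    unfolding coact_Z_def by (subst kron_mult) (auto intro: mat_1_commute mat_1_commute[symmetric])
  moreover have "coact_Z ** kron ?N (mat 1) = kron (T\<^sub>1 ** T\<^sub>2 ** ?N) ?S"
    unfolding coact_Z_def by (subst kron_mult) (auto simp: scal_commute)
  ultimately show ?thesis
    by (simp add: map_matrix_scal_kron)
qed

text \<open>Right multiplication by \<open>N\<close> acts on the upper index pair, hence the
  transpose. That pair is transformed by S_2S_1, the inverse of T_1T_2, which therefore commutes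
  with \<open>N\<close> too.\<close>

lemma coact_Z_right:
  assumes "rtt_commuting R N"
  shows "rtt_meq R (map_matrix scal (kron (mat 1) (transpose N)) ** coact_Z)
    (coact_Z ** map_matrix scal (kron (mat 1) (transpose N)))"
proof -
  let ?N = "map_matrix scal N" and ?S = "S\<^sub>2 ** S\<^sub>1"
  have "rtt_meq R (?S ** ?N) (?N ** ?S)"
    using assms rtt_T1T2S2S1 rtt_S2S1T1T2 unfolding rtt_commuting_def by (rule rtt_meq_inverse_commute)
  then have "rtt_meq R (transpose (?S ** ?N)) (transpose (?N ** ?S))"
    by (simp add: rtt_meq_def transpose_def)
  \<comment> \<open>Transposition reverses these products because the entries of \<open>?N\<close>
    are central.\<close>
  moreover have "transpose (?S ** ?N) = transpose ?N ** transpose ?S"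
    "transpose (?N ** ?S) = transpose ?S ** transpose ?N"
    by (simp_all add: vec_eq_iff transpose_def matrix_matrix_mult_def scal_commute)
  ultimately have "rtt_meq R (kron (T\<^sub>1 ** T\<^sub>2) (transpose ?N ** transpose ?S))
      (kron (T\<^sub>1 ** T\<^sub>2) (transpose ?S ** transpose ?N))"
    by (simp add: rtt_meq_kron_right)
  moreover have "kron (mat 1) (transpose ?N) ** coact_Z
      = kron (T\<^sub>1 ** T\<^sub>2) (transpose ?N ** transpose ?S)"
    unfolding coact_Z_def by (subst kron_mult) (auto simp: transpose_def scal_commute)
  moreover have "coact_Z ** kron (mat 1) (transpose ?N)
      = kron (T\<^sub>1 ** T\<^sub>2) (transpose ?S ** transpose ?N)"
    unfolding coact_Z_def by (subst kron_mult) (auto intro: mat_1_commute mat_1_commute[symmetric])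
  ultimately show ?thesis
    by (simp add: map_matrix_scal_kron map_matrix_scal_transpose)
qed

section \<open>Composing and inverting intertwiners\<close>

lemma intertwiner_mult:
  assumes "rtt_meq R (A ** D) (D ** A)" and "rtt_meq R (X ** C) (D ** X)"
  shows "rtt_meq R (A ** X ** C) (D ** (A ** X))"
proof -
  have "rtt_meq R (A ** X ** C) (A ** D ** X)"
    using rtt_meq_mult_left[OF assms(2), of A] by (simp add: matrix_mul_assoc)
  also have "rtt_meq R (A ** D ** X) (D ** (A ** X))"
    using rtt_meq_mult_right[OF assms(1), of X] by (simp add: matrix_mul_assoc)
  finally show ?thesis .
qed

text \<open>The inverse \<open>Z\<close> of the intertwiner \<open>X\<close> is an intertwiner in
  the opposite direction, so it can be composed with \<open>Y\<close>. The resulting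
  \<open>Z ** Y\<close> carries each row of \<open>X\<close> to the same row of
  \<open>Y\<close>.\<close>

lemma intertwiner_quotient:
  assumes "rtt_meq R (X ** C) (D ** X)" and "rtt_meq R (Y ** C) (D ** Y)"
    and "X ** Z = mat 1" and "Z ** X = mat 1"
  shows "rtt_meq R (Z ** Y ** C) (C ** (Z ** Y))"
proof -
  have "rtt_meq R (C ** Z) (Z ** D)"
    using rtt_meq_mult_right[OF rtt_meq_mult_left[OF assms(1), of Z], of Z]
    by (simp add: matrix_mul_assoc assms(4)) (simp flip: matrix_mul_assoc add: assms(3))
  then have "rtt_meq R (C ** (Z ** Y)) (Z ** D ** Y)"
    using rtt_meq_mult_right[of R "C ** Z" "Z ** D" Y] by (simp add: matrix_mul_assoc)
  moreover have "rtt_meq R (Z ** Y ** C) (Z ** D ** Y)"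
    using rtt_meq_mult_left[OF assms(2), of Z] by (simp add: matrix_mul_assoc)
  ultimately show ?thesis
    by (blast intro: rtt_meq_trans rtt_meq_sym)
qed

text \<open>The matrix is block diagonal in the outer indices i and k, and every block is R with its
  indices rearranged. Skew-invertibility inverts exactly this rearrangement.\<close>

lemma LML_coeff_invertible:
  assumes "skew_invertible R"
  obtains Z where "LML_coeff R ** Z = mat 1" "Z ** LML_coeff R = mat 1"
proof -
  obtain \<Psi> where \<Psi>: "trace2 (emb12 \<Psi> ** emb23 R) = flip"
    using assms by (auto simp: skew_invertible_def)
  \<comment> \<open>The partial trace identity in entries; the flip pairs (i, j) with (j,
    i).\<close>
  have *: "(\<Sum>a\<in>UNIV. \<Sum>b\<in>UNIV. R $ (a, j) $ (b, l) * \<Psi> $ (i, b) $ (c, a)) = (if c = j \<and> l = i then 1 else 0)"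
    for i j c l
  proof -
    have "(\<Sum>b\<in>UNIV. \<Sum>a\<in>UNIV. \<Psi> $ (i, b) $ (c, a) * R $ (a, j) $ (b, l)) = flip $ (i, j) $ (c, l)"
      unfolding \<Psi>[symmetric]
      by (simp add: trace2_def emb12_def emb23_def matrix_matrix_mult_def sum_UNIV_prod
          delta_simps cong: if_cong)
    then show ?thesis
      by (subst sum.swap) (simp add: flip_def mult.commute)
  qed
  \<comment> \<open>Each block of \<open>Z\<close> is \<Psi> with its indices permuted so that the
    product of blocks becomes the sum in \<open>*\<close>.\<close>
  define Z :: "'a^(('b \<times> 'b) \<times> ('b \<times> 'b))^(('b \<times> 'b) \<times> ('b \<times> 'b))"
    where "Z = (\<chi> c p. case (p, c) of (((i, j), (k, l)), ((i', a), (b, k'))) \<Rightarrow>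
      if i = i' \<and> k = k' then \<Psi> $ (l, b) $ (j, a) else 0)"
  have "(LML_coeff R ** Z) $ ((i, j), (k, l)) $ ((i', j'), (k', l'))
      = mat 1 $ ((i, j), (k, l)) $ ((i', j'), (k', l'))"
    for i j k l i' j' k' l'
  proof -
    have "(LML_coeff R ** Z) $ ((i, j), (k, l)) $ ((i', j'), (k', l')) =
      (if i = i' \<and> k = k' then \<Sum>a\<in>UNIV. \<Sum>b\<in>UNIV. R $ (a, j) $ (b, l) * \<Psi> $ (l', b) $ (j', a) else 0)"
      by (simp add: matrix_matrix_mult_def sum_UNIV_prod LML_coeff_def Z_def
          delta_simps cong: if_cong)
    then show ?thesis
      by (auto simp: * mat_def)
  qed
  then have "LML_coeff R ** Z = mat 1"
    by (auto simp: vec_eq_iff)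
  then show thesis
    using that matrix_left_right_inverse by blast
qed


section \<open>The relations\<close>

text \<open>Row i of \<open>B\<close> is the image of the i-th basis vector. Coacting after the map
  therefore gives \<open>B ** C\<close>, and applying the map after the coaction gives
  \<open>C ** B\<close>, with \<open>B\<close> made of scalars.\<close>

lemma comodule_morphism_matrix:
  assumes "rtt_meq R (map_matrix scal B ** C) (C ** map_matrix scal B)"
  shows "comodule_morphism R C C (\<lambda>v. v v* B)"
  unfolding comodule_morphism_def
proof (intro conjI allI)
  show "Vector_Spaces.linear (*s) (*s) (\<lambda>v. v v* B)"
    by unfold_locales
      (simp_all add: vec_eq_iff vector_matrix_mult_def algebra_simps sum.distrib sum_distrib_left)
next
  fix v m
  have swap: "scal b * (scal a * c) = scal a * (c * scal b)"
    for a b :: 'a and c :: "('b, 'a) rtt_free"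
    by (simp only: scal_commute[of c] scal_left_commute[of "scal a"])
  have "coaction C (v v* B) $ m =
      (\<Sum>k\<in>UNIV. \<Sum>i\<in>UNIV. scal (v $ i) * (scal (B $ i $ k) * C $ k $ m))"
    by (simp add: coaction_def vector_matrix_mult_def fscale_def scal_sum sum_distrib_right
        mult.commute[of "B $ _ $ _"] scal_mult mult.assoc)
  also have "\<dots> = (\<Sum>i\<in>UNIV. scal (v $ i) * (map_matrix scal B ** C) $ i $ m)"
    by (subst sum.swap) (simp add: matrix_matrix_mult_def sum_distrib_left)
  finally have coaction: "coaction C (v v* B) $ m = \<dots>" .
  have "id_tensor (\<lambda>v. v v* B) (coaction C v) $ m =
      (\<Sum>k\<in>UNIV. \<Sum>i\<in>UNIV. scal (B $ k $ m) * (scal (v $ i) * C $ i $ k))"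
    by (simp add: coaction_def id_tensor_def vector_matrix_mult_def fscale_def axis_def
        sum_distrib_left delta_simps cong: if_cong)
  also have "\<dots> = (\<Sum>i\<in>UNIV. scal (v $ i) * (C ** map_matrix scal B) $ i $ m)"
    by (subst sum.swap) (simp add: matrix_matrix_mult_def sum_distrib_left swap)
  finally have "id_tensor (\<lambda>v. v v* B) (coaction C v) $ m = \<dots>" .
  with coaction show "rtt_eq R (coaction C (v v* B) $ m) (id_tensor (\<lambda>v. v v* B) (coaction C v) $ m)"
    using assms by (auto simp: rtt_meq_def intro!: rtt_eq_sum rtt_eq_mult_left)
qed

section \<open>Matrices of quadratic elements and their coefficients\<close>

lemma quad_linear: "Vector_Spaces.linear (*s) fscale (quad :: 'k::field^(('n \<times> 'n) \<times> ('n::finite \<times> 'n)) \<Rightarrow> _)"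
proof -
  interpret V: vector_space "(*s) :: 'k \<Rightarrow> 'k^(('n \<times> 'n) \<times> ('n \<times> 'n)) \<Rightarrow> _"
    by (rule vec.vector_space_axioms)
  interpret F: vector_space "fscale :: 'k \<Rightarrow> ('n, 'k) tensor_End \<Rightarrow> _"
    by (rule vector_space_fscale)
  show ?thesis
    by unfold_locales
      (simp_all add: quad_def split_def F.scale_left_distrib sum.distrib F.scale_sum_right)
qed

lemma span_rows: "vec.span (range (\<lambda>p. Y $ p)) = range (\<lambda>v. v v* (Y :: 'k::field^'m^'n))"
proof
  show "vec.span (range (\<lambda>p. Y $ p)) \<subseteq> range (\<lambda>v. v v* Y)"
  proof (rule vec.span_minimal)
    have "Y $ p = axis p 1 v* Y" for p
      by (simp add: vec_eq_iff vector_matrix_mult_def axis_def delta_simps cong: if_cong)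
    then show "range (\<lambda>p. Y $ p) \<subseteq> range (\<lambda>v. v v* Y)" by blast
    have "0 = 0 v* Y" by simp
    then have "0 \<in> range (\<lambda>v. v v* Y)" by (rule range_eqI)
    then show "vec.subspace (range (\<lambda>v. v v* Y))"
      unfolding vec.subspace_def
      by (auto simp flip: vector_matrix_left_distrib scalar_vector_matrix_assoc)
  qed
next
  show "range (\<lambda>v. v v* Y) \<subseteq> vec.span (range (\<lambda>p. Y $ p))"
  proof
    fix x assume "x \<in> range (\<lambda>v. v v* Y)"
    then obtain v where "x = v v* Y" by blast
    then have "x = (\<Sum>p\<in>UNIV. v $ p *s Y $ p)"
      by (simp add: vec_eq_iff vector_matrix_mult_def mult.commute)
    then show "x \<in> vec.span (range (\<lambda>p. Y $ p))"
      by (simp add: vec.span_sum vec.span_scale vec.span_base)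
  qed
qed

text \<open>Translates a matrix of coefficients, one row per entry, into a matrix over the tensor
  algebra, so that the relations can be handled through coefficients alone.\<close>

definition quad_mat ::
    "'k::field^(('n \<times> 'n) \<times> ('n \<times> 'n))^(('n \<times> 'n) \<times> ('n::finite \<times> 'n))
      \<Rightarrow> ('n, 'k) tensor_End^('n \<times> 'n)^('n \<times> 'n)"
  where "quad_mat Y = (\<chi> p r. quad (Y $ (p, r)))"

lemma quad_mat_LML:
  "quad_mat (LML_coeff M) = kron L_mat (mat 1) ** map_matrix scal M ** kron L_mat (mat 1)"
proof -
  have "quad_mat (LML_coeff M) $ (i, j) $ (k, l) =
    (kron L_mat (mat 1) ** map_matrix scal M ** kron L_mat (mat 1)) $ (i, j) $ (k, l)" for i j k l
  proof -
    have "quad_mat (LML_coeff M) $ (i, j) $ (k, l) =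
      (\<Sum>a\<in>UNIV. \<Sum>b\<in>UNIV. scal (M $ (a, j) $ (b, l)) * (gen (i, a) * gen (b, k)))"
      by (simp add: quad_mat_def quad_def sum_UNIV_prod LML_coeff_def fscale_def
            delta_simps cong: if_cong)
    also have "\<dots> = (\<Sum>a\<in>UNIV. \<Sum>b\<in>UNIV. gen (i, a) * scal (M $ (a, j) $ (b, l)) * gen (b, k))"
      by (simp add: mult.assoc scal_commute scal_left_commute)
    also have "\<dots> = (kron L_mat (mat 1) ** map_matrix scal M ** kron L_mat (mat 1)) $ (i, j) $ (k, l)"
      by (subst sum.swap)
        (simp add: mult_kron_left_1_nth kron_left_1_mult_nth L_mat_def sum_distrib_right)
    finally show ?thesis .
  qed
  then show ?thesis
    by (auto simp: vec_eq_iff)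
qed

lemma quad_mat_diff: "quad_mat (X - Y) = quad_mat X - quad_mat Y"
proof -
  interpret Vector_Spaces.linear "(*s)" fscale "quad :: 'b^(('a \<times> 'a) \<times> ('a \<times> 'a)) \<Rightarrow> _"
    by (rule quad_linear)
  show ?thesis
    by (simp add: vec_eq_iff quad_mat_def diff)
qed

lemma quad_mat_left:
  "quad_mat (kron N (mat 1) ** Y) = map_matrix scal N ** quad_mat Y"
proof -
  interpret Vector_Spaces.linear "(*s)" fscale "quad :: 'b^(('a \<times> 'a) \<times> ('a \<times> 'a)) \<Rightarrow> _"
    by (rule quad_linear)
  have *: "(kron N (mat 1) ** Y) $ (p, r) = (\<Sum>a\<in>UNIV. N $ p $ a *s Y $ (a, r))" for p r
    by (simp add: vec_eq_iff kron_left_1_mult_nth)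
  have "quad_mat (kron N (mat 1) ** Y) $ p $ r = (\<Sum>a\<in>UNIV. scal (N $ p $ a) * quad (Y $ (a, r)))"
    for p r
    by (simp add: quad_mat_def * sum scale fscale_def)
  then show ?thesis
    by (simp add: vec_eq_iff matrix_matrix_mult_def quad_mat_def)
qed

text \<open>The scalar entries of \<open>N\<close> may stand on either side of the quadratic
  elements, so a right factor becomes a left action on coefficients through the transpose.\<close>

lemma quad_mat_right:
  "quad_mat (kron (mat 1) (transpose N) ** Y) = quad_mat Y ** map_matrix scal N"
proof -
  interpret Vector_Spaces.linear "(*s)" fscale "quad :: 'b^(('a \<times> 'a) \<times> ('a \<times> 'a)) \<Rightarrow> _"
    by (rule quad_linear)
  have *: "(kron (mat 1) (transpose N) ** Y) $ (p, r) = (\<Sum>a\<in>UNIV. N $ a $ r *s Y $ (p, a))" for p r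
    by (simp add: vec_eq_iff kron_right_1_mult_nth transpose_def)
  have "quad_mat (kron (mat 1) (transpose N) ** Y) $ p $ r =
      (\<Sum>a\<in>UNIV. scal (N $ a $ r) * quad (Y $ (p, a)))" for p r
    by (simp add: quad_mat_def * sum scale fscale_def)
  then show ?thesis
    by (simp add: vec_eq_iff matrix_matrix_mult_def quad_mat_def scal_commute)
qed

text \<open>Linear maps carry spans to spans, and the span of the rows of \<open>Y\<close> is the
  image of multiplication by \<open>Y\<close>.\<close>

lemma span_entries_quad_mat:
  "module.span fscale (entries (quad_mat Y)) = quad ` range (\<lambda>v. v v* Y)"
proof -
  interpret Vector_Spaces.linear "(*s)" fscale "quad :: 'b^(('a \<times> 'a) \<times> ('a \<times> 'a)) \<Rightarrow> _"
    by (rule quad_linear)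
  have "entries (quad_mat Y) = quad ` range (\<lambda>p. Y $ p)"
    by (force simp: entries_def quad_mat_def)
  then show ?thesis
    by (simp only: span_image span_rows)
qed

theorem proposition7:
  fixes q :: "'k::real_normed_field"
    and R :: "'k^('n::finite \<times> 'n)^('n \<times> 'n)"
    and \<epsilon>\<^sub>1 \<epsilon>\<^sub>2 \<epsilon>\<^sub>3 \<epsilon>\<^sub>4 :: int
  assumes "Hecke_symmetry q R"
    and "skew_invertible R"
    and "\<epsilon>\<^sub>1 \<in> {1, -1}" and "\<epsilon>\<^sub>2 \<in> {1, -1}" and "\<epsilon>\<^sub>3 \<in> {1, -1}" and "\<epsilon>\<^sub>4 \<in> {1, -1}"
  shows "admissible R (entries (L_system R \<epsilon>\<^sub>1 \<epsilon>\<^sub>2 \<epsilon>\<^sub>3 \<epsilon>\<^sub>4))"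
proof -
  let ?X = "\<lambda>e. LML_coeff (sign_power R e)"
  let ?A = "kron (sign_power R \<epsilon>\<^sub>1) (mat 1)"
  let ?B = "kron (mat 1) (transpose (sign_power R \<epsilon>\<^sub>4))"
  \<comment> \<open>The coefficients of the relations: \<open>?A\<close> multiplies L_1 R^e L_1 with
    e = \<open>\<epsilon>\<^sub>2\<close> from the left, and \<open>?B\<close> multiplies the one
    with e = \<open>\<epsilon>\<^sub>3\<close> from the right.\<close>
  define Y where "Y = ?A ** ?X \<epsilon>\<^sub>2 - ?B ** ?X \<epsilon>\<^sub>3"
  have "invertible R"
    using assms(1) by (simp add: Hecke_symmetry_def)
  note comm = rtt_commuting_sign_power[OF this]
  have Y: "rtt_meq R (map_matrix scal Y ** coact_End2) (coact_Z ** map_matrix scal Y)"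
    unfolding Y_def map_matrix_scal_diff map_matrix_scal_mult matrix_sub_rdistrib matrix_sub_ldistrib
    by (intro rtt_meq_diff intertwiner_mult LML_coeff_intertwines coact_Z_left coact_Z_right comm)
  obtain Z where Z: "LML_coeff R ** Z = mat 1" "Z ** LML_coeff R = mat 1"
    using LML_coeff_invertible[OF assms(2)] .
  let ?\<beta> = "\<lambda>v. v v* (Z ** Y)"
  have "rtt_meq R (map_matrix scal (Z ** Y) ** coact_End2) (coact_End2 ** map_matrix scal (Z ** Y))"
    unfolding map_matrix_scal_mult
    by (rule intertwiner_quotient[OF LML_coeff_intertwines[OF rtt_commuting_R] Y])
      (simp_all flip: map_matrix_scal_mult add: Z)
  then have "comodule_morphism R coact_End2 coact_End2 ?\<beta>"
    by (rule comodule_morphism_matrix)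
  moreover have "L_system R \<epsilon>\<^sub>1 \<epsilon>\<^sub>2 \<epsilon>\<^sub>3 \<epsilon>\<^sub>4 = quad_mat Y"
    by (simp add: Y_def L_system_def Let_def quad_mat_diff quad_mat_left quad_mat_right quad_mat_LML
        matrix_mul_assoc)
  \<comment> \<open>As \<open>Z\<close> is invertible, the factor \<open>Z\<close> only
    reparametrizes the argument.\<close>
  moreover have "range (\<lambda>v. v v* Y) = range ?\<beta>"
  proof -
    have "v v* Y = ?\<beta> (v v* LML_coeff R)" for v
      by (simp add: vector_matrix_mul_assoc matrix_mul_assoc Z)
    moreover have "?\<beta> v = (v v* Z) v* Y" for v
      by (simp add: vector_matrix_mul_assoc)
    ultimately show ?thesis by blast
  qed
  ultimately show ?thesis
    unfolding admissible_def by (metis span_entries_quad_mat)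
qed

end
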